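(* Let $M$ be a closed orientable smooth $n$-manifold and let $\rho(M)$ be a simple, index-ordered round handle decomposition $M=\sum_{i=1}^{m_0}R^0_i+\cdots+\sum_{i=1}^{m_{n-1}}R^{n-1}_i$ with associated filtration $\emptyset=M^{(-1)}\subset M^{(0)}\subset\cdots\subset M^{(n-1)}=M$. Put $C^{\mathrm{RHD}}_k(\rho(M))=H_{k+1}(M^{(k)},M^{(k-1)})$, and let $\partial^{\mathrm{RHD}}_k:C^{\mathrm{RHD}}_k(\rho(M))\to C^{\mathrm{RHD}}_{k-1}(\rho(M))$ be the connecting homomorphism $H_{k+1}(M^{(k)},M^{(k-1)})\to H_k(M^{(k-1)},M^{(k-2)})$ of the long exact homology sequence of the triple $(M^{(k)},M^{(k-1)},M^{(k-2)})$. Then $\{C^{\mathrm{RHD}}_k(\rho(M)),\partial^{\mathrm{RHD}}_k\}$ is a chain complex (that is, $\partial^{\mathrm{RHD}}_{k-1}\circ\partial^{\mathrm{RHD}}_k=0$ for all $k$), so that its homology, a graded group denoted $H^{\mathrm{RHD}}_*(\rho(M))$, is defined.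
   Context: All manifolds are smooth and orientable; homology is singular homology with coefficients in $\mathbb{Z}$. A manifold pair $(W,\partial_-W)$ is a compact connected manifold $W$ together with a union $\partial_-W$ of connected components of $\partial W$; $\partial_+W=\partial W\setminus\partial_-W$. For $0\le k\le n-1$, a trivial $n$-dimensional round $k$-handle is $R^k=S^1\times D^k\times D^{n-k-1}$ with $\partial_-R^k=S^1\times\partial D^k\times D^{n-k-1}$ and $\partial_+R^k=S^1\times D^k\times\partial D^{n-k-1}$; its core circle is $S^1\times\{0\}\times\{0\}$. Attaching $R^k$ to $W$ along an embedding $\alpha:\partial_-R^k\to\partial_+W$ yields $W+R^k=W\cup_\alpha R^k$, with $\partial_-(W+R^k)=\partial_-W$ and $\partial_+(W+R^k)=(\partial_+W\setminus\mathrm{Im}\,\alpha)\cup\partial_+R^k$. A round handle decomposition (RHD) of a closed manifold $M$ is a representation of $M$ as the result of successively attaching round handles starting from the empty set; it is simple if all its round handles are trivial. It is index-ordered if handles are attached in ascending order of index and handles of the same index are attached independently, i.e. $\partial_-R^k_i\cap\partial_+R^k_j=\emptyset$. The associated filtration is $M^{(-1)}=\emptyset$ and $M^{(k)}=M^{(k-1)}+\sum_{i=1}^{m_k}R^k_i$ for $0\le k\le n-1$; put $M^{(k)}=\emptyset$ for $k<-1$ and $C^{\mathrm{RHD}}_k=0$ for $k<0$ or $k>n-1$. *)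

theory Defs
  imports "HOL-Analysis.Analysis" "HOL-Homology.Homology" "Jordan_Normal_Form.Determinant"
begin

section \<open>Smooth functions on subsets of Euclidean space\<close>

text \<open>
  Points of \<open>\<real>\<^sup>N\<close> are the points of \<^term>\<open>Euclidean_space N\<close>, i.e. functions \<open>nat \<Rightarrow> real\<close>
  vanishing from \<open>N\<close> on. On an open set, \<open>f\<close> is smooth iff all its iterated partial derivatives
  exist and are continuous; \<open>D (i # is)\<close> is the \<open>i\<close>-th partial derivative of \<open>D is\<close>.
\<close>

definition smooth_on_open :: "nat \<Rightarrow> (nat \<Rightarrow> real) set \<Rightarrow> ((nat \<Rightarrow> real) \<Rightarrow> real) \<Rightarrow> bool" where
  "smooth_on_open N G f \<longleftrightarrow>
     openin (Euclidean_space N) G \<and>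
     (\<exists>D :: nat list \<Rightarrow> (nat \<Rightarrow> real) \<Rightarrow> real.
        (\<forall>x\<in>G. D [] x = f x) \<and>
        (\<forall>is. set is \<subseteq> {..<N} \<longrightarrow>
           continuous_map (subtopology (Euclidean_space N) G) euclideanreal (D is) \<and>
           (\<forall>i<N. \<forall>x\<in>G.
              ((\<lambda>t. D is (x(i := t))) has_real_derivative D (i # is) x) (at (x i)))))"

text \<open>On an arbitrary subset, smooth means locally extendable to a smooth function on an open set.\<close>

definition smooth_function :: "nat \<Rightarrow> (nat \<Rightarrow> real) set \<Rightarrow> ((nat \<Rightarrow> real) \<Rightarrow> real) \<Rightarrow> bool" where
  "smooth_function N S f \<longleftrightarrow>
     S \<subseteq> topspace (Euclidean_space N) \<and>
     (\<forall>x\<in>S. \<exists>G g. x \<in> G \<and> smooth_on_open N G g \<and> (\<forall>y\<in>S \<inter> G. g y = f y))"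

definition smooth_map ::
    "nat \<Rightarrow> (nat \<Rightarrow> real) set \<Rightarrow> nat \<Rightarrow> ((nat \<Rightarrow> real) \<Rightarrow> (nat \<Rightarrow> real)) \<Rightarrow> bool" where
  "smooth_map N S N' f \<longleftrightarrow>
     f ` S \<subseteq> topspace (Euclidean_space N') \<and> (\<forall>i<N'. smooth_function N S (\<lambda>x. f x i))"

text \<open>
  Partial derivatives are taken within \<open>S\<close>; for \<open>S\<close> open in a half-space they are one-sided in the
  normal direction at boundary points.
\<close>

definition jacobian_det ::
    "nat \<Rightarrow> (nat \<Rightarrow> real) set \<Rightarrow> ((nat \<Rightarrow> real) \<Rightarrow> (nat \<Rightarrow> real)) \<Rightarrow> (nat \<Rightarrow> real) \<Rightarrow> real" where
  "jacobian_det n S f y =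
     Determinant.det (Matrix.mat n n (\<lambda>(i, j).
       vector_derivative (\<lambda>t. f (y(j := t)) i) (at (y j) within {t. y(j := t) \<in> S})))"


section \<open>Smooth manifolds with boundary\<close>

type_synonym 'a chart = "'a set \<times> ('a \<Rightarrow> nat \<Rightarrow> real)"

record 'a smooth_space =
  Dim :: nat
  Top :: "'a topology"
  Atlas :: "'a chart set"

abbreviation points :: "'a smooth_space \<Rightarrow> 'a set" where
  "points X \<equiv> topspace (Top X)"

text \<open>For \<open>n = 0\<close> the condition \<open>0 \<le> x 0\<close> is void.\<close>

definition half_space :: "nat \<Rightarrow> (nat \<Rightarrow> real) topology" where
  "half_space n = subtopology (Euclidean_space n) {x. 0 \<le> x 0}"

definition is_chart :: "nat \<Rightarrow> 'a topology \<Rightarrow> 'a chart \<Rightarrow> bool" where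
  "is_chart n X = (\<lambda>(U, \<phi>).
     openin X U \<and> openin (half_space n) (\<phi> ` U) \<and>
     homeomorphic_map (subtopology X U) (subtopology (half_space n) (\<phi> ` U)) \<phi>)"

definition smooth_atlas :: "nat \<Rightarrow> 'a topology \<Rightarrow> 'a chart set \<Rightarrow> bool" where
  "smooth_atlas n X A \<longleftrightarrow>
     (\<forall>c\<in>A. is_chart n X c) \<and>
     topspace X = (\<Union>(U, \<phi>)\<in>A. U) \<and>
     (\<forall>(U, \<phi>)\<in>A. \<forall>(V, \<psi>)\<in>A. smooth_map n (\<phi> ` (U \<inter> V)) n (\<psi> \<circ> inv_into U \<phi>))"

text \<open>
  An orientation assigns to each point of each chart a sign, comparing the orientation of the
  tangent space there with the one given by the chart. (Requiring an atlas of half-space charts with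
  positive transition determinants instead would make a compact interval non-orientable.)
\<close>

definition orientable :: "'a smooth_space \<Rightarrow> bool" where
  "orientable X \<longleftrightarrow>
     (\<exists>\<epsilon> :: 'a chart \<Rightarrow> 'a \<Rightarrow> real.
        (\<forall>(U, \<phi>)\<in>Atlas X.
           \<epsilon> (U, \<phi>) ` U \<subseteq> {-1, 1} \<and>
           continuous_map (subtopology (Top X) U) euclideanreal (\<epsilon> (U, \<phi>))) \<and>
        (\<forall>(U, \<phi>)\<in>Atlas X. \<forall>(V, \<psi>)\<in>Atlas X. \<forall>x\<in>U \<inter> V.
           \<epsilon> (V, \<psi>) x =
             sgn (jacobian_det (Dim X) (\<phi> ` (U \<inter> V)) (\<psi> \<circ> inv_into U \<phi>) (\<phi> x)) * \<epsilon> (U, \<phi>) x))"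

definition compact_manifold :: "nat \<Rightarrow> 'a smooth_space \<Rightarrow> bool" where
  "compact_manifold n X \<longleftrightarrow>
     Dim X = n \<and> compact_space (Top X) \<and> Hausdorff_space (Top X) \<and> second_countable (Top X) \<and>
     smooth_atlas n (Top X) (Atlas X) \<and> orientable X"

definition manifold_boundary :: "'a smooth_space \<Rightarrow> 'a set" where
  "manifold_boundary X = {x. 0 < Dim X \<and> (\<exists>(U, \<phi>)\<in>Atlas X. x \<in> U \<and> \<phi> x 0 = 0)}"

definition closed_manifold :: "nat \<Rightarrow> 'a smooth_space \<Rightarrow> bool" where
  "closed_manifold n X \<longleftrightarrow> compact_manifold n X \<and> manifold_boundary X = {}"

definition euclid :: "nat \<Rightarrow> (nat \<Rightarrow> real) smooth_space" where
  "euclid N = \<lparr>Dim = N, Top = Euclidean_space N, Atlas = {(topspace (Euclidean_space N), id)}\<rparr>"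

definition smooth_between ::
    "'a smooth_space \<Rightarrow> 'a set \<Rightarrow> 'b smooth_space \<Rightarrow> ('a \<Rightarrow> 'b) \<Rightarrow> bool" where
  "smooth_between X S Y f \<longleftrightarrow>
     S \<subseteq> points X \<and>
     continuous_map (subtopology (Top X) S) (Top Y) f \<and>
     (\<forall>(U, \<phi>)\<in>Atlas X. \<forall>(V, \<psi>)\<in>Atlas Y.
        smooth_map (Dim X) (\<phi> ` (S \<inter> U \<inter> f -` V)) (Dim Y) (\<psi> \<circ> f \<circ> inv_into U \<phi>))"

text \<open>
  A diffeomorphism from \<open>S\<close> onto its image; when \<open>S\<close> is a submanifold (possibly with corners), this
  is a smooth embedding.
\<close>

definition smooth_embedding ::
    "'a smooth_space \<Rightarrow> 'a set \<Rightarrow> 'b smooth_space \<Rightarrow> ('a \<Rightarrow> 'b) \<Rightarrow> bool" where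
  "smooth_embedding X S Y f \<longleftrightarrow>
     inj_on f S \<and> smooth_between X S Y f \<and> smooth_between Y (f ` S) X (inv_into S f)"


section \<open>Trivial round handles and their attachment\<close>

text \<open>
  \<open>R\<^sup>k = S\<^sup>1 \<times> D\<^sup>k \<times> D\<^sup>n\<^sup>-\<^sup>k\<^sup>-\<^sup>1\<close> lies in \<open>\<real>\<^sup>2 \<times> \<real>\<^sup>k \<times> \<real>\<^sup>n\<^sup>-\<^sup>k\<^sup>-\<^sup>1 = \<real>\<^sup>n\<^sup>+\<^sup>1\<close>: the coordinates \<open>0, 1\<close> belong to
  the circle, \<open>2, \<dots>, k + 1\<close> to \<open>D\<^sup>k\<close>, and \<open>k + 2, \<dots>, n\<close> to \<open>D\<^sup>n\<^sup>-\<^sup>k\<^sup>-\<^sup>1\<close>. A ball of dimension zero is a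
  point with empty boundary, since an empty sum is not \<open>1\<close>.
\<close>

definition norm_p :: "nat \<Rightarrow> (nat \<Rightarrow> real) \<Rightarrow> real" where
  "norm_p k x = sqrt (\<Sum>i = 2..<k + 2. (x i)\<^sup>2)"

definition norm_q :: "nat \<Rightarrow> nat \<Rightarrow> (nat \<Rightarrow> real) \<Rightarrow> real" where
  "norm_q n k x = sqrt (\<Sum>i = k + 2..<n + 1. (x i)\<^sup>2)"

definition round_ambient :: "nat \<Rightarrow> (nat \<Rightarrow> real) set" where
  "round_ambient n = {x \<in> topspace (Euclidean_space (n + 1)). (x 0)\<^sup>2 + (x 1)\<^sup>2 = 1}"

definition round_handle :: "nat \<Rightarrow> nat \<Rightarrow> (nat \<Rightarrow> real) set" where
  "round_handle n k = {x \<in> round_ambient n. norm_p k x \<le> 1 \<and> norm_q n k x \<le> 1}"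

definition round_handle_minus :: "nat \<Rightarrow> nat \<Rightarrow> (nat \<Rightarrow> real) set" where
  "round_handle_minus n k = {x \<in> round_handle n k. norm_p k x = 1}"

definition round_handle_plus :: "nat \<Rightarrow> nat \<Rightarrow> (nat \<Rightarrow> real) set" where
  "round_handle_plus n k = {x \<in> round_handle n k. norm_q n k x = 1}"

definition round_handle_corner :: "nat \<Rightarrow> nat \<Rightarrow> (nat \<Rightarrow> real) set" where
  "round_handle_corner n k = round_handle_minus n k \<inter> round_handle_plus n k"

text \<open>
  \<open>X'\<close> is, as a topological space, the adjunction space \<open>X \<union>\<^sub>\<alpha> R\<^sup>k\<close>, where \<open>X\<close> is identified with its
  image and \<open>h\<close> is the canonical map of \<open>R\<^sup>k\<close>; the last clause is the quotient topology.
\<close>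

definition adjunction_space ::
    "nat \<Rightarrow> nat \<Rightarrow> 'a topology \<Rightarrow> ((nat \<Rightarrow> real) \<Rightarrow> 'a) \<Rightarrow> ((nat \<Rightarrow> real) \<Rightarrow> 'a) \<Rightarrow> 'a topology \<Rightarrow> bool"
  where
  "adjunction_space n k X \<alpha> h X' \<longleftrightarrow>
     (\<forall>x\<in>round_handle_minus n k. h x = \<alpha> x) \<and>
     inj_on h (round_handle n k - round_handle_minus n k) \<and>
     h ` (round_handle n k - round_handle_minus n k) \<inter> topspace X = {} \<and>
     topspace X' = topspace X \<union> h ` round_handle n k \<and>
     (\<forall>G. openin X' G \<longleftrightarrow>
        G \<subseteq> topspace X' \<and>
        openin X (G \<inter> topspace X) \<and>
        openin (subtopology (Euclidean_space (n + 1)) (round_handle n k))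
               {x \<in> round_handle n k. h x \<in> G})"

text \<open>
  The adjunction space has a concave corner along the image of \<open>S\<^sup>1 \<times> \<partial>D\<^sup>k \<times> \<partial>D\<^sup>n\<^sup>-\<^sup>k\<^sup>-\<^sup>1\<close>, and its smooth
  structure is the usual one obtained by straightening the angle. A point near the corner of \<open>R\<^sup>k\<close>
  in \<open>S\<^sup>1 \<times> \<real>\<^sup>k \<times> \<real>\<^sup>n\<^sup>-\<^sup>k\<^sup>-\<^sup>1\<close> is written \<open>(z, p, q)\<close>, with complex corner coordinate
  \<open>w = (1 - |p|) + \<i> (1 - |q|)\<close>. The handle is the quadrant \<open>Re w \<ge> 0, Im w \<ge> 0\<close>, with \<open>Re w = 0\<close>
  on \<open>\<partial>\<^sub>-R\<^sup>k\<close>. A collar of \<open>X\<close> is modelled on \<open>Re w \<le> 0\<close>. Their union is the sector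
  \<open>0 \<le> arg w \<le> 3\<pi>/2\<close>, which is the image of the half-plane \<open>Im w \<ge> 0\<close> under multiplication of
  arguments by \<open>3/2\<close>.
\<close>

definition corner_coord :: "nat \<Rightarrow> nat \<Rightarrow> (nat \<Rightarrow> real) \<Rightarrow> complex" where
  "corner_coord n k x = Complex (1 - norm_p k x) (1 - norm_q n k x)"

definition corner_tube :: "nat \<Rightarrow> nat \<Rightarrow> real \<Rightarrow> (nat \<Rightarrow> real) set" where
  "corner_tube n k \<epsilon> = {x \<in> round_ambient n. cmod (corner_coord n k x) < \<epsilon>}"

definition unstraighten :: "nat \<Rightarrow> nat \<Rightarrow> (nat \<Rightarrow> real) \<Rightarrow> (nat \<Rightarrow> real)" where
  "unstraighten n k x =
     (let w = corner_coord n k x; w' = rcis (cmod w) (3 / 2 * Arg w)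
      in (\<lambda>i. if i < 2 then x i
              else if i < k + 2 then (1 - Re w') / (1 - Re w) * x i
              else (1 - Im w') / (1 - Im w) * x i))"

definition straightened_corner ::
    "nat \<Rightarrow> nat \<Rightarrow> 'a smooth_space \<Rightarrow> ((nat \<Rightarrow> real) \<Rightarrow> 'a) \<Rightarrow> 'a smooth_space \<Rightarrow> bool" where
  "straightened_corner n k X h X' \<longleftrightarrow>
     (\<exists>\<epsilon> H. 0 < \<epsilon> \<and> \<epsilon> \<le> 1 \<and>
        (let T = corner_tube n k \<epsilon>;
             collar = {x \<in> T. 1 \<le> norm_p k x};
             half = {x \<in> T. norm_q n k x \<le> 1}
         in (\<forall>x\<in>T \<inter> round_handle n k. H x = h x) \<and>
            smooth_embedding (euclid (n + 1)) collar X H \<and>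
            openin (Top X) (H ` collar) \<and>
            smooth_embedding (euclid (n + 1)) half X' (H \<circ> unstraighten n k) \<and>
            openin (Top X') ((H \<circ> unstraighten n k) ` half)))"

text \<open>
  \<open>X' = X + R\<^sup>k\<close>, attached along \<open>\<alpha>\<close>. Starting from the empty set one always has \<open>\<partial>\<^sub>-X = \<emptyset>\<close>, so that
  \<open>\<partial>\<^sub>+X\<close> is the whole boundary of \<open>X\<close>.
\<close>

definition attaches_round_handle ::
    "nat \<Rightarrow> nat \<Rightarrow> 'a smooth_space \<Rightarrow> ((nat \<Rightarrow> real) \<Rightarrow> 'a) \<Rightarrow> ((nat \<Rightarrow> real) \<Rightarrow> 'a) \<Rightarrow>
     'a smooth_space \<Rightarrow> bool" where
  "attaches_round_handle n k X \<alpha> h X' \<longleftrightarrow>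
     k < n \<and> compact_manifold n X \<and> compact_manifold n X' \<and>
     smooth_embedding (euclid (n + 1)) (round_handle_minus n k) X \<alpha> \<and>
     \<alpha> ` round_handle_minus n k \<subseteq> manifold_boundary X \<and>
     adjunction_space n k (Top X) \<alpha> h (Top X') \<and>
     smooth_embedding X (points X - h ` round_handle_corner n k) X' id \<and>
     smooth_embedding (euclid (n + 1)) (round_handle n k - round_handle_corner n k) X' h \<and>
     straightened_corner n k X h X'"


section \<open>Round handle decompositions\<close>

text \<open>
  \<open>stage \<rho> j\<close> is the result of attaching the first \<open>j\<close> handles; \<open>attaching \<rho> j\<close> and \<open>handle \<rho> j\<close> are
  the attaching map and the canonical map of handle number \<open>j\<close>, whose index is \<open>index \<rho> j\<close>.
\<close>

record 'a round_handle_decomposition =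
  handles :: nat
  index :: "nat \<Rightarrow> nat"
  attaching :: "nat \<Rightarrow> (nat \<Rightarrow> real) \<Rightarrow> 'a"
  handle :: "nat \<Rightarrow> (nat \<Rightarrow> real) \<Rightarrow> 'a"
  stage :: "nat \<Rightarrow> 'a smooth_space"

definition simple_RHD :: "nat \<Rightarrow> 'a smooth_space \<Rightarrow> 'a round_handle_decomposition \<Rightarrow> bool" where
  "simple_RHD n M \<rho> \<longleftrightarrow>
     points (stage \<rho> 0) = {} \<and>
     (\<forall>j<handles \<rho>. attaches_round_handle n (index \<rho> j) (stage \<rho> j)
                      (attaching \<rho> j) (handle \<rho> j) (stage \<rho> (Suc j))) \<and>
     stage \<rho> (handles \<rho>) = M"

definition index_ordered :: "nat \<Rightarrow> 'a round_handle_decomposition \<Rightarrow> bool" where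
  "index_ordered n \<rho> \<longleftrightarrow>
     (\<forall>i j. i \<le> j \<and> j < handles \<rho> \<longrightarrow> index \<rho> i \<le> index \<rho> j) \<and>
     (\<forall>i<handles \<rho>. \<forall>j<handles \<rho>. i \<noteq> j \<and> index \<rho> i = index \<rho> j \<longrightarrow>
        handle \<rho> i ` round_handle_minus n (index \<rho> i) \<inter>
        handle \<rho> j ` round_handle_plus n (index \<rho> j) = {})"

text \<open>
  When the indices ascend, the handles of index at most \<open>k\<close> are exactly the first ones, as many as
  there are such handles. So this is \<open>\<emptyset>\<close> for \<open>k < 0\<close> and \<open>M\<close> for \<open>k \<ge> n - 1\<close>.
\<close>

definition filtration :: "'a round_handle_decomposition \<Rightarrow> int \<Rightarrow> 'a set" where
  "filtration \<rho> k = points (stage \<rho> (card {j. j < handles \<rho> \<and> int (index \<rho> j) \<le> k}))"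


section \<open>The chain complex\<close>

definition C_RHD ::
    "'a smooth_space \<Rightarrow> 'a round_handle_decomposition \<Rightarrow> int \<Rightarrow> 'a chain set monoid"
  where
  "C_RHD M \<rho> k =
     relative_homology_group (k + 1) (subtopology (Top M) (filtration \<rho> k)) (filtration \<rho> (k - 1))"

text \<open>\<^const>\<open>hom_relboundary\<close> is the connecting homomorphism of the sequence of a triple.\<close>

definition boundary_RHD ::
    "'a smooth_space \<Rightarrow> 'a round_handle_decomposition \<Rightarrow> int \<Rightarrow>
     'a chain set \<Rightarrow> 'a chain set" where
  "boundary_RHD M \<rho> k =
     hom_relboundary (k + 1) (subtopology (Top M) (filtration \<rho> k))
       (filtration \<rho> (k - 1)) (filtration \<rho> (k - 2))"

definition is_chain_complex ::
    "(int \<Rightarrow> ('g, 'm) monoid_scheme) \<Rightarrow> (int \<Rightarrow> 'g \<Rightarrow> 'g) \<Rightarrow> bool" where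
  "is_chain_complex C d \<longleftrightarrow>
     (\<forall>k. comm_group (C k)) \<and>
     (\<forall>k. d k \<in> hom (C k) (C (k - 1))) \<and>
     (\<forall>k. \<forall>c\<in>carrier (C k). d (k - 1) (d k c) = \<one>\<^bsub>C (k - 2)\<^esub>)"

definition cycle_group ::
    "(int \<Rightarrow> ('g, 'm) monoid_scheme) \<Rightarrow> (int \<Rightarrow> 'g \<Rightarrow> 'g) \<Rightarrow> int \<Rightarrow> ('g, 'm) monoid_scheme" where
  "cycle_group C d k = (C k)\<lparr>carrier := kernel (C k) (C (k - 1)) (d k)\<rparr>"

definition boundary_set ::
    "(int \<Rightarrow> ('g, 'm) monoid_scheme) \<Rightarrow> (int \<Rightarrow> 'g \<Rightarrow> 'g) \<Rightarrow> int \<Rightarrow> 'g set" where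
  "boundary_set C d k = d (k + 1) ` carrier (C (k + 1))"

definition H_RHD ::
    "'a smooth_space \<Rightarrow> 'a round_handle_decomposition \<Rightarrow> int \<Rightarrow>
     'a chain set set monoid" where
  "H_RHD M \<rho> k =
     cycle_group (C_RHD M \<rho>) (boundary_RHD M \<rho>) k Mod
     boundary_set (C_RHD M \<rho>) (boundary_RHD M \<rho>) k"

end

(* The only input from the decomposition is that attaching a handle enlarges the stage, so that the
   filtration is increasing and constant outside the range of the indices. The composite of two
   connecting homomorphisms of triples factors through two consecutive maps
   H_k(B) --> H_k(B, C) --> H_{k-1}(C) of the exact sequence of the pair (B, C), whose composite
   vanishes. *)
theory Submission
  imports Defs
begin

lemma comm_group_subgroup:
  assumes "comm_group G" "subgroup H G"
  shows "comm_group (G\<lparr>carrier := H\<rparr>)"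
proof -
  interpret comm_group G by fact
  have "group (G\<lparr>carrier := H\<rparr>)"
    using assms(2) is_group by (rule subgroup.subgroup_is_group)
  then show ?thesis
    by (rule group.group_comm_groupI) (use assms(2) in \<open>auto intro: m_comm dest: subgroup.mem_carrier\<close>)
qed

text \<open>\<open>Mod\<close> forms cosets for arbitrary arguments; the first part is what makes it
  a quotient of groups. Boundaries are cycles because \<open>d\<close> squares to zero, and
  commutativity makes every subgroup normal.\<close>

lemma chain_complex_homology:
  assumes "is_chain_complex C d"
  shows "subgroup (boundary_set C d k) (cycle_group C d k)"
    and "comm_group (cycle_group C d k Mod boundary_set C d k)"
proof -
  have comm: "comm_group (C i)" and hom: "d i \<in> hom (C i) (C (i - 1))"
    and dd: "c \<in> carrier (C i) \<Longrightarrow> d (i - 1) (d i c) = \<one>\<^bsub>C (i - 2)\<^esub>" for i c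
    using assms by (auto simp: is_chain_complex_def)
  have gh: "group_hom (C i) (C (i - 1)) (d i)" for i
    using comm[of i] comm[of "i - 1"] hom[of i]
    by (simp add: group_hom_def group_hom_axioms_def comm_group.axioms)
  have ker: "subgroup (kernel (C k) (C (k - 1)) (d k)) (C k)"
    by (rule group_hom.subgroup_kernel[OF gh])
  have img: "subgroup (boundary_set C d k) (C k)"
    using group_hom.img_is_subgroup[OF gh[of "k + 1"]] by (simp add: boundary_set_def)
  have "boundary_set C d k \<subseteq> kernel (C k) (C (k - 1)) (d k)"
    using dd[of _ "k + 1"] hom_in_carrier[OF hom[of "k + 1"]]
    by (auto simp: boundary_set_def kernel_def)
  then show sub: "subgroup (boundary_set C d k) (cycle_group C d k)"
    unfolding cycle_group_def
    using group.subgroup_incl[OF comm_group.axioms(2)[OF comm] img ker] by blast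
  have "comm_group (cycle_group C d k)"
    unfolding cycle_group_def using comm ker by (rule comm_group_subgroup)
  then show "comm_group (cycle_group C d k Mod boundary_set C d k)"
    using sub by (rule comm_group.abelian_FactGroup)
qed

lemma hom_relboundary_hom_relboundary:
  "hom_relboundary (p - 1) (subtopology X S) T U (hom_relboundary p X S T c) =
     \<one>\<^bsub>relative_homology_group (p - 2) (subtopology (subtopology X S) T) U\<^esub>"
proof -
  let ?Y = "subtopology X S"
  \<comment> \<open>Each \<open>hom_relboundary\<close> is a \<open>hom_boundary\<close> followed by
    a map induced by inclusion. These are the middle two of the four maps, consecutive in the
    sequence of the pair \<open>(?Y, T)\<close>; the inner \<open>hom_boundary\<close> lands in the
    carrier for every \<open>c\<close>.\<close>
  have "hom_boundary (p - 1) ?Y T (hom_induced (p - 1) ?Y {} ?Y T id (hom_boundary p X S c)) =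
      \<one>\<^bsub>homology_group (p - 2) (subtopology ?Y T)\<^esub>"
    using homology_exactness_axiom_1[of "p - 1" ?Y T] hom_boundary_carrier[of p X S c]
    by (auto simp: kernel_def)
  \<comment> \<open>The last of the four maps is a homomorphism and preserves the identity.\<close>
  then show ?thesis
    unfolding hom_relboundary_def
    using hom_one[OF hom_induced_hom group_relative_homology_group group_relative_homology_group,
        of "p - 2" "subtopology ?Y T" "{}" "subtopology ?Y T" U id]
    by simp
qed

text \<open>An adjunction space contains the points of the previous stage literally, not through an
  embedding. Stages after number \<open>handles \<rho>\<close> are unconstrained, hence the bound on
  \<open>j\<close>.\<close>

lemma stage_mono:
  assumes "simple_RHD n M \<rho>" "i \<le> j" "j \<le> handles \<rho>"
  shows "points (stage \<rho> i) \<subseteq> points (stage \<rho> j)"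
  using assms(2,3)
proof (induction rule: dec_induct)
  case (step m)
  then have "attaches_round_handle n (index \<rho> m) (stage \<rho> m) (attaching \<rho> m) (handle \<rho> m)
      (stage \<rho> (Suc m))"
    using assms(1) by (auto simp: simple_RHD_def)
  then have "points (stage \<rho> m) \<subseteq> points (stage \<rho> (Suc m))"
    by (auto simp: attaches_round_handle_def adjunction_space_def)
  with step show ?case by simp
qed simp

lemma filtration_mono:
  assumes "simple_RHD n M \<rho>" "k \<le> l"
  shows "filtration \<rho> k \<subseteq> filtration \<rho> l"
  unfolding filtration_def
proof (rule stage_mono[OF assms(1)])
  show "card {j. j < handles \<rho> \<and> int (index \<rho> j) \<le> k} \<le>
      card {j. j < handles \<rho> \<and> int (index \<rho> j) \<le> l}"
    using assms(2) by (intro card_mono) auto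
  have "card {j. j < handles \<rho> \<and> int (index \<rho> j) \<le> l} \<le> card {..<handles \<rho>}"
    by (intro card_mono) auto
  then show "card {j. j < handles \<rho> \<and> int (index \<rho> j) \<le> l} \<le> handles \<rho>"
    by simp
qed

lemma filtration_negative:
  assumes "simple_RHD n M \<rho>" "k < 0"
  shows "filtration \<rho> k = {}"
proof -
  have none: "{j. j < handles \<rho> \<and> int (index \<rho> j) \<le> k} = {}"
    using assms(2) by auto
  show ?thesis
    using assms(1) unfolding filtration_def none by (simp add: simple_RHD_def)
qed

lemma filtration_top:
  assumes "simple_RHD n M \<rho>" "k \<ge> int n - 1"
  shows "filtration \<rho> k = points M"
proof -
  \<comment> \<open>Attachment demands that the index lie below \<open>n\<close>, so from level
    \<open>n - 1\<close> on every handle is counted.\<close>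
  have "index \<rho> j < n" if "j < handles \<rho>" for j
    using assms(1) that by (auto simp: simple_RHD_def attaches_round_handle_def)
  then have all: "{j. j < handles \<rho> \<and> int (index \<rho> j) \<le> k} = {..<handles \<rho>}"
    using assms(2) by fastforce
  show ?thesis
    using assms(1) unfolding filtration_def all by (simp add: simple_RHD_def)
qed

text \<open>Connecting maps end in groups of iterated subtopologies, whereas \<open>C_RHD\<close>
  restricts \<open>Top M\<close> only once; this identifies the two.\<close>

lemma subtopology_filtration:
  assumes "simple_RHD n M \<rho>" "k \<le> l"
  shows "subtopology (subtopology X (filtration \<rho> l)) (filtration \<rho> k) =
    subtopology X (filtration \<rho> k)"
  using filtration_mono[OF assms] by (simp add: subtopology_subtopology inf.absorb2)

lemma chain_complex_RHD:
  assumes "simple_RHD n M \<rho>"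
  shows "is_chain_complex (C_RHD M \<rho>) (boundary_RHD M \<rho>)"
  unfolding is_chain_complex_def
proof (intro conjI allI ballI)
  fix k
  show "comm_group (C_RHD M \<rho> k)"
    by (simp add: C_RHD_def)
  show "boundary_RHD M \<rho> k \<in> hom (C_RHD M \<rho> k) (C_RHD M \<rho> (k - 1))"
    using group_homomorphism_hom_relboundary[of "k + 1" "subtopology (Top M) (filtration \<rho> k)"
        "filtration \<rho> (k - 1)" "filtration \<rho> (k - 2)"]
    by (simp add: C_RHD_def boundary_RHD_def subtopology_filtration[OF assms])
  \<comment> \<open>With \<open>p = k + 1\<close>, the degree \<open>p - 2\<close> is the degree
    \<open>(k - 2) + 1\<close> of \<open>C_RHD M \<rho> (k - 2)\<close>.\<close>
  show "boundary_RHD M \<rho> (k - 1) (boundary_RHD M \<rho> k c) = \<one>\<^bsub>C_RHD M \<rho> (k - 2)\<^esub>" for c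
    using hom_relboundary_hom_relboundary[of "k + 1" "subtopology (Top M) (filtration \<rho> k)"
        "filtration \<rho> (k - 1)" "filtration \<rho> (k - 2)" "filtration \<rho> (k - 3)" c]
    by (simp add: C_RHD_def boundary_RHD_def subtopology_filtration[OF assms])
qed

text \<open>The convention that the groups vanish outside the range of indices is a consequence of
  the definition of \<open>C_RHD\<close> for all integers.\<close>

lemma trivial_C_RHD:
  assumes "simple_RHD n M \<rho>" "k < 0 \<or> k > int n - 1"
  shows "trivial_group (C_RHD M \<rho> k)"
  using assms(2)
proof
  assume "k < 0"
  then show ?thesis
    using filtration_negative[OF assms(1)]
    by (simp add: C_RHD_def trivial_relative_homology_group_empty)
next
  assume "k > int n - 1"
  \<comment> \<open>The strict inequality puts \<open>k - 1\<close> in the top range as well, so the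
    pair is \<open>M\<close> relative to itself.\<close>
  then have "filtration \<rho> k = points M" "filtration \<rho> (k - 1) = points M"
    using filtration_top[OF assms(1)] by auto
  then show ?thesis
    by (simp add: C_RHD_def trivial_relative_homology_group_topspace)
qed

theorem theorem1:
  fixes n :: nat and M :: "'a smooth_space" and \<rho> :: "'a round_handle_decomposition"
  assumes "closed_manifold n M"
    and "simple_RHD n M \<rho>"
    and "index_ordered n \<rho>"
  shows "is_chain_complex (C_RHD M \<rho>) (boundary_RHD M \<rho>)
    \<and> (\<forall>k. k < 0 \<or> k > int n - 1 \<longrightarrow> trivial_group (C_RHD M \<rho> k))
    \<and> (\<forall>k. subgroup (boundary_set (C_RHD M \<rho>) (boundary_RHD M \<rho>) k)
                    (cycle_group (C_RHD M \<rho>) (boundary_RHD M \<rho>) k)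
          \<and> comm_group (H_RHD M \<rho> k))"
  using chain_complex_RHD[OF assms(2)] trivial_C_RHD[OF assms(2)]
  by (auto simp: H_RHD_def chain_complex_homology)

end
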